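(* Let $D$ be a VFD, let $n\in\mathbb{N}$ be a positive integer, let $(a_i)_{i=1}^n$ be a sequence of valuation elements of $D$ and let $a=\prod_{i=1}^n a_i$. The following statements are equivalent. (1) $a_i$ and $a_j$ are incomparable for all distinct $i,j\in[1,n]$. (2) $\sqrt{a_iD}$ and $\sqrt{a_jD}$ are incomparable under inclusion for all distinct $i,j\in[1,n]$. (3) The map $f:[1,n]\to\mathcal{P}(aD)$ given by $f(i)=\sqrt{a_iD}$ is a well-defined bijection. (4) $n=|\mathcal{P}(aD)|$. Hence, every nonzero nonunit of $D$ can be written as a finite product of (pairwise) incomparable valuation elements.
   Context: Let $D$ be an integral domain with quotient field $K$. An overring of $D$ is a subring of $K$ containing $D$. A nonzero nonunit $a\in D$ is a valuation element of $D$ if there is a valuation domain $V$ that is an overring of $D$ with $aV\cap D=aD$. $D$ is a VFD (valuation factorization domain) if every nonzero nonunit of $D$ is a finite product of valuation elements. Two elements $x,y\in D$ are incomparable if the ideals $xD$ and $yD$ are incomparable under inclusion. For an ideal $I$ of $D$, $\mathcal{P}(I)$ denotes the set of minimal prime ideals of $I$ (primes minimal over $I$). $[1,n]=\{k\in\mathbb{N}\mid 1\le k\le n\}$. *)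

theory Defs
  imports "HOL-Algebra.Algebra"
begin

text \<open>
  The quotient field \<open>K\<close> of \<open>D\<close> is taken to contain \<open>D\<close>: both are rings over the same element
  type, and \<open>D\<close> carries the operations of \<open>K\<close>. Overrings of \<open>D\<close> are then sets of elements of \<open>K\<close>.
\<close>

definition quotient_field :: "('a, 'm) ring_scheme \<Rightarrow> ('a, 'm) ring_scheme \<Rightarrow> bool" where
  "quotient_field D K \<longleftrightarrow>
     field K \<and> subring (carrier D) K \<and> D = K\<lparr>carrier := carrier D\<rparr> \<and>
     (\<forall>x\<in>carrier K. \<exists>a\<in>carrier D. \<exists>b\<in>carrier D - {\<zero>\<^bsub>K\<^esub>}. x = a \<otimes>\<^bsub>K\<^esub> inv\<^bsub>K\<^esub> b)"

definition overring :: "('a, 'm) ring_scheme \<Rightarrow> ('a, 'm) ring_scheme \<Rightarrow> 'a set \<Rightarrow> bool" where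
  "overring D K V \<longleftrightarrow> subring V K \<and> carrier D \<subseteq> V"

definition valuation_domain :: "('a, 'm) ring_scheme \<Rightarrow> ('a, 'm) ring_scheme \<Rightarrow> bool" where
  "valuation_domain V K \<longleftrightarrow>
     domain V \<and> quotient_field V K \<and>
     (\<forall>x\<in>carrier K - {\<zero>\<^bsub>K\<^esub>}. x \<in> carrier V \<or> inv\<^bsub>K\<^esub> x \<in> carrier V)"

definition nonzero_nonunits :: "('a, 'm) ring_scheme \<Rightarrow> 'a set" where
  "nonzero_nonunits D = carrier D - {\<zero>\<^bsub>D\<^esub>} - Units D"

definition valuation_element :: "('a, 'm) ring_scheme \<Rightarrow> ('a, 'm) ring_scheme \<Rightarrow> 'a \<Rightarrow> bool" where
  "valuation_element D K a \<longleftrightarrow>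
     a \<in> nonzero_nonunits D \<and>
     (\<exists>V. overring D K V \<and> valuation_domain (K\<lparr>carrier := V\<rparr>) K \<and>
          (PIdl\<^bsub>K\<lparr>carrier := V\<rparr>\<^esub> a) \<inter> carrier D = PIdl\<^bsub>D\<^esub> a)"

definition VFD :: "('a, 'm) ring_scheme \<Rightarrow> ('a, 'm) ring_scheme \<Rightarrow> bool" where
  "VFD D K \<longleftrightarrow>
     (\<forall>x\<in>nonzero_nonunits D.
        \<exists>(n::nat) b. n \<ge> 1 \<and> (\<forall>i\<in>{1..n}. valuation_element D K (b i)) \<and>
           x = (\<Otimes>\<^bsub>D\<^esub>i\<in>{1..n}. b i))"

definition incomparable_ideals :: "'a set \<Rightarrow> 'a set \<Rightarrow> bool" where
  "incomparable_ideals I J \<longleftrightarrow> \<not> I \<subseteq> J \<and> \<not> J \<subseteq> I"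

definition incomparable :: "('a, 'm) ring_scheme \<Rightarrow> 'a \<Rightarrow> 'a \<Rightarrow> bool" where
  "incomparable D x y \<longleftrightarrow> incomparable_ideals (PIdl\<^bsub>D\<^esub> x) (PIdl\<^bsub>D\<^esub> y)"

definition ideal_radical :: "('a, 'm) ring_scheme \<Rightarrow> 'a set \<Rightarrow> 'a set" where
  "ideal_radical D I = {x \<in> carrier D. \<exists>m::nat. m \<ge> 1 \<and> x [^]\<^bsub>D\<^esub> m \<in> I}"

definition minimal_primes :: "('a, 'm) ring_scheme \<Rightarrow> 'a set \<Rightarrow> 'a set set" where
  "minimal_primes D I =
     {P. primeideal P D \<and> I \<subseteq> P \<and> (\<forall>Q. primeideal Q D \<and> I \<subseteq> Q \<and> Q \<subseteq> P \<longrightarrow> Q = P)}"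

end

theory Submission
  imports Defs
begin

text \<open>
  Let \<open>a\<close> be a valuation element, contracted from the valuation overring \<open>V\<close>. Cancelling \<open>a\<close>, the
  equation \<open>aV \<inter> D = aD\<close> says that \<open>t \<in> V\<close> and \<open>at \<in> D\<close> imply \<open>t \<in> D\<close>. In this form it is clear
  that, for a fixed \<open>V\<close>, the nonzero elements of \<open>D\<close> contracted from \<open>V\<close> are a multiplicative set
  closed under divisors (\<open>contracted_mult_iff\<close>), and that any two of them are comparable in \<open>D\<close>:
  one of the two quotients lies in \<open>V\<close>, hence in \<open>D\<close> (\<open>contracted_comparable\<close>).

  The equivalence of \<open>S1\<close> and \<open>S2\<close> follows, one direction being the monotonicity of
  radicals. If \<open>\<surd>(aD) \<subseteq> \<surd>(bD)\<close> for valuation elements \<open>a\<close> and \<open>b\<close>, then \<open>b\<close> divides a power of \<open>a\<close>; that power is contracted from the overring of \<open>a\<close>, therefore so is \<open>b\<close>,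
  and \<open>a\<close> and \<open>b\<close> are comparable (\<open>incomparable_iff_radicals_incomparable\<close>).

  Divisibility in \<open>V\<close> also shows that \<open>\<surd>(aD)\<close> is a prime ideal (\<open>radical_primeideal\<close>). A prime
  containing a product contains a factor, so the minimal primes of the product are the minimal
  members of the finite family of radicals of the factors. That \<open>S2\<close>, \<open>S3\<close> and \<open>S4\<close> are equivalent is
  then a statement about finite families of sets (\<open>minimal_elements_of_finite_family\<close>).

  Finally, if \<open>a\<close> divides \<open>b\<close> and both are valuation elements, then \<open>ab\<close> divides \<open>b\<^sup>2\<close>, so \<open>ab\<close> is
  contracted from the overring of \<open>b\<close> and is a valuation element. Merging comparable factors
  therefore turns any factorization into an incomparable one.
\<close>

section \<open>Minimal members of a finite family of sets\<close>

text \<open>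
  The last condition gives back the first by counting: \<open>M\<close> is contained in the image of \<open>f\<close>, which
  has at most \<open>card I\<close> members, so equality of cardinalities forces \<open>f\<close> to be injective and every
  member of its image to be minimal.
\<close>

lemma minimal_elements_of_finite_family:
  fixes f :: "'i \<Rightarrow> 'b set"
  assumes fin: "finite I"
    and M: "M = {P \<in> f ` I. \<forall>Q \<in> f ` I. Q \<subseteq> P \<longrightarrow> Q = P}"
  shows "(\<forall>i\<in>I. \<forall>j\<in>I. i \<noteq> j \<longrightarrow> incomparable_ideals (f i) (f j)) \<longleftrightarrow> bij_betw f I M"
    and "bij_betw f I M \<longleftrightarrow> finite M \<and> card I = card M"
proof -
  let ?inc = "\<forall>i\<in>I. \<forall>j\<in>I. i \<noteq> j \<longrightarrow> incomparable_ideals (f i) (f j)"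
  have sub: "M \<subseteq> f ` I" and finM: "finite M"
    using M fin by auto
  have 1: "bij_betw f I M" if ?inc
  proof -
    have "inj_on f I"
      using that unfolding inj_on_def incomparable_ideals_def by blast
    moreover have "Q = P" if "P \<in> f ` I" "Q \<in> f ` I" "Q \<subseteq> P" for P Q
      using that \<open>?inc\<close> unfolding incomparable_ideals_def by (metis imageE)
    then have "f ` I = M" unfolding M by blast
    ultimately show ?thesis by (simp add: bij_betw_def)
  qed
  have 2: "finite M \<and> card I = card M" if "bij_betw f I M"
    using that finM bij_betw_same_card by blast
  have 3: ?inc if "finite M \<and> card I = card M"
  proof -
    have "card (f ` I) \<le> card M" using that card_image_le[OF fin, of f] by simp
    then have eq: "M = f ` I"
      using sub fin by (simp add: card_seteq)
    then have inj: "inj_on f I"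
      using that fin by (simp add: eq_card_imp_inj_on)
    show ?thesis
    proof (intro ballI impI)
      fix i j assume ij: "i \<in> I" "j \<in> I" "i \<noteq> j"
      then have ne: "f i \<noteq> f j" using inj by (auto dest: inj_onD)
      have "f i \<in> M" "f j \<in> M" using ij eq by auto
      then show "incomparable_ideals (f i) (f j)"
        using ne ij unfolding M incomparable_ideals_def by blast
    qed
  qed
  show "?inc \<longleftrightarrow> bij_betw f I M" "bij_betw f I M \<longleftrightarrow> finite M \<and> card I = card M"
    using 1 2 3 by blast+
qed

section \<open>Prime ideals containing a product\<close>

lemma (in primeideal) finprod_mem_iff:
  assumes "finite A" and "f \<in> A \<rightarrow> carrier R"
  shows "finprod R f A \<in> I \<longleftrightarrow> (\<exists>i\<in>A. f i \<in> I)"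
  using assms
proof (induction A)
  case empty
  then show ?case using I_notcarr one_imp_carrier by auto
next
  case (insert x F)
  then have fx: "f x \<in> carrier R" and fF: "f \<in> F \<rightarrow> carrier R" by auto
  have "finprod R f (insert x F) = f x \<otimes> finprod R f F"
    using insert.hyps fx fF by (simp add: finprod_insert)
  moreover have "f x \<otimes> finprod R f F \<in> I \<longleftrightarrow> f x \<in> I \<or> finprod R f F \<in> I"
    using I_prime I_l_closed I_r_closed fx finprod_closed[OF fF] by blast
  ultimately show ?case using insert.IH[OF fF] by auto
qed

lemma (in primeideal) nat_pow_mem_imp_mem:
  assumes "x \<in> carrier R" and "x [^] (m::nat) \<in> I"
  shows "x \<in> I"
  using assms(2)
proof (induction m)
  case 0
  then show ?case using I_notcarr one_imp_carrier by auto
next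
  case (Suc m)
  then show ?case using I_prime[of "x [^] m" x] assms(1) by auto
qed

text \<open>
  The family \<open>S\<close> is cofinal from below among the primes over \<open>I\<close>, so minimality can be tested
  inside \<open>S\<close>.
\<close>

lemma (in cring) minimal_primes_eq_minimal_elements:
  assumes primes: "\<And>P. P \<in> S \<Longrightarrow> primeideal P R \<and> I \<subseteq> P"
    and below: "\<And>P. primeideal P R \<Longrightarrow> I \<subseteq> P \<Longrightarrow> \<exists>Q\<in>S. Q \<subseteq> P"
  shows "minimal_primes R I = {P \<in> S. \<forall>Q\<in>S. Q \<subseteq> P \<longrightarrow> Q = P}"
proof (intro equalityI subsetI)
  fix P assume "P \<in> minimal_primes R I"
  then have P: "primeideal P R" "I \<subseteq> P"
    and min: "\<And>Q. primeideal Q R \<Longrightarrow> I \<subseteq> Q \<Longrightarrow> Q \<subseteq> P \<Longrightarrow> Q = P"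
    unfolding minimal_primes_def by auto
  obtain Q where "Q \<in> S" "Q \<subseteq> P" using below[OF P] by blast
  then have "P \<in> S" using min primes by blast
  then show "P \<in> {P \<in> S. \<forall>Q\<in>S. Q \<subseteq> P \<longrightarrow> Q = P}" using min primes by blast
next
  fix P assume P: "P \<in> {P \<in> S. \<forall>Q\<in>S. Q \<subseteq> P \<longrightarrow> Q = P}"
  have "Q = P" if Q: "primeideal Q R" "I \<subseteq> Q" "Q \<subseteq> P" for Q
  proof -
    obtain Q' where "Q' \<in> S" "Q' \<subseteq> Q" using below Q by blast
    then show ?thesis using P Q(3) by blast
  qed
  then show "P \<in> minimal_primes R I"
    using P primes unfolding minimal_primes_def by blast
qed

section \<open>Elements contracted from a valuation overring\<close>

locale domain_in_quotient_field = D: domain D + K: field K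
  for D K :: "('a, 'm) ring_scheme" +
  assumes quotient: "quotient_field D K"
begin

lemma carrier_subset: "x \<in> carrier D \<Longrightarrow> x \<in> carrier K"
  using quotient subringE(1) unfolding quotient_field_def by blast

lemma restriction: "D = K\<lparr>carrier := carrier D\<rparr>"
  using quotient unfolding quotient_field_def by blast

text \<open>
  Rewriting the operations of \<open>D\<close> to those of \<open>K\<close> puts every computation in one structure.
\<close>

lemma operations_agree [simp]:
  "x \<otimes>\<^bsub>D\<^esub> y = x \<otimes>\<^bsub>K\<^esub> y" "x \<oplus>\<^bsub>D\<^esub> y = x \<oplus>\<^bsub>K\<^esub> y" "\<one>\<^bsub>D\<^esub> = \<one>\<^bsub>K\<^esub>" "\<zero>\<^bsub>D\<^esub> = \<zero>\<^bsub>K\<^esub>"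
  by (subst restriction, simp)+

lemma nat_pow_agree [simp]: "x [^]\<^bsub>D\<^esub> (m::nat) = x [^]\<^bsub>K\<^esub> m"
  by (simp add: nat_pow_def)

lemma m_closed [intro]: "x \<in> carrier D \<Longrightarrow> y \<in> carrier D \<Longrightarrow> x \<otimes>\<^bsub>K\<^esub> y \<in> carrier D"
  using D.m_closed by simp

lemma nat_pow_closed [intro]: "x \<in> carrier D \<Longrightarrow> x [^]\<^bsub>K\<^esub> (m::nat) \<in> carrier D"
  using D.nat_pow_closed by simp

lemma PIdl_eq: "PIdl\<^bsub>D\<^esub> a = {a \<otimes>\<^bsub>K\<^esub> d | d. d \<in> carrier D}" if "a \<in> carrier D"
  unfolding cgenideal_def operations_agree
  using that K.m_comm carrier_subset by (intro Collect_cong) metis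

definition valuation_overring :: "'a set \<Rightarrow> bool" where
  "valuation_overring V \<longleftrightarrow> overring D K V \<and> valuation_domain (K\<lparr>carrier := V\<rparr>) K"

text \<open>
  The equation \<open>aV \<inter> D = aD\<close> with the factor \<open>a\<close> cancelled. Units of \<open>D\<close> are admitted,
  so that the contracted elements form a submonoid.
\<close>

definition contracted :: "'a set \<Rightarrow> 'a \<Rightarrow> bool" where
  "contracted V a \<longleftrightarrow> a \<in> carrier D - {\<zero>\<^bsub>K\<^esub>} \<and>
     (\<forall>t\<in>V. a \<otimes>\<^bsub>K\<^esub> t \<in> carrier D \<longrightarrow> t \<in> carrier D)"

lemma valuation_overring_subring:
  assumes "valuation_overring V"
  shows "subring V K" and "carrier D \<subseteq> V"
  using assms unfolding valuation_overring_def overring_def by auto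

lemma valuation_element_iff_contracted:
  "valuation_element D K a \<longleftrightarrow>
     a \<in> nonzero_nonunits D \<and> (\<exists>V. valuation_overring V \<and> contracted V a)"
proof -
  have "PIdl\<^bsub>K\<lparr>carrier := V\<rparr>\<^esub> a \<inter> carrier D = PIdl\<^bsub>D\<^esub> a \<longleftrightarrow> contracted V a"
    if a: "a \<in> nonzero_nonunits D" and V: "valuation_overring V" for V
  proof -
    have aD: "a \<in> carrier D" "a \<noteq> \<zero>\<^bsub>K\<^esub>" and aK: "a \<in> carrier K"
      using a carrier_subset unfolding nonzero_nonunits_def by auto
    have VK: "V \<subseteq> carrier K" and DV: "carrier D \<subseteq> V"
      using valuation_overring_subring[OF V] subringE(1) by blast+
    have PV: "PIdl\<^bsub>K\<lparr>carrier := V\<rparr>\<^esub> a = {a \<otimes>\<^bsub>K\<^esub> t | t. t \<in> V}"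
      unfolding cgenideal_def by (auto, (metis K.m_comm VK aK subsetD)+)
    have cancel: "a \<otimes>\<^bsub>K\<^esub> t = a \<otimes>\<^bsub>K\<^esub> d \<longleftrightarrow> t = d" if "t \<in> V" "d \<in> carrier D" for t d
      using that VK aK aD carrier_subset K.m_lcancel by blast
    have "PIdl\<^bsub>D\<^esub> a \<subseteq> PIdl\<^bsub>K\<lparr>carrier := V\<rparr>\<^esub> a \<inter> carrier D"
      unfolding PV PIdl_eq[OF aD(1)] using DV aD by auto
    moreover have "PIdl\<^bsub>K\<lparr>carrier := V\<rparr>\<^esub> a \<inter> carrier D \<subseteq> PIdl\<^bsub>D\<^esub> a \<longleftrightarrow>
        (\<forall>t\<in>V. a \<otimes>\<^bsub>K\<^esub> t \<in> carrier D \<longrightarrow> t \<in> carrier D)"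
      unfolding PV PIdl_eq[OF aD(1)] using cancel by blast
    ultimately show ?thesis using aD unfolding contracted_def by blast
  qed
  then show ?thesis
    unfolding valuation_element_def valuation_overring_def by blast
qed

text \<open>
  From \<open>at \<in> D\<close> follows \<open>abt \<in> D\<close>, which gives closure under divisors. Conversely \<open>abt \<in> D\<close> with
  \<open>t \<in> V\<close> gives \<open>bt \<in> D\<close> because \<open>bt \<in> V\<close>, and then \<open>t \<in> D\<close>.
\<close>

lemma contracted_mult_iff:
  assumes V: "valuation_overring V" and a: "a \<in> carrier D" and b: "b \<in> carrier D"
  shows "contracted V (a \<otimes>\<^bsub>K\<^esub> b) \<longleftrightarrow> contracted V a \<and> contracted V b"
proof
  have K: "a \<in> carrier K" "b \<in> carrier K" using a b carrier_subset by auto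
  have VK: "V \<subseteq> carrier K" and DV: "carrier D \<subseteq> V"
    using valuation_overring_subring[OF V] subringE(1) by blast+
  {
    assume c: "contracted V (a \<otimes>\<^bsub>K\<^esub> b)"
    then have nz: "a \<noteq> \<zero>\<^bsub>K\<^esub>" "b \<noteq> \<zero>\<^bsub>K\<^esub>" using K unfolding contracted_def by auto
    have "t \<in> carrier D" if t: "t \<in> V" and at: "a \<otimes>\<^bsub>K\<^esub> t \<in> carrier D \<or> b \<otimes>\<^bsub>K\<^esub> t \<in> carrier D" for t
    proof -
      have tK: "t \<in> carrier K" using t VK by auto
      have "a \<otimes>\<^bsub>K\<^esub> b \<otimes>\<^bsub>K\<^esub> t = b \<otimes>\<^bsub>K\<^esub> (a \<otimes>\<^bsub>K\<^esub> t)" "a \<otimes>\<^bsub>K\<^esub> b \<otimes>\<^bsub>K\<^esub> t = a \<otimes>\<^bsub>K\<^esub> (b \<otimes>\<^bsub>K\<^esub> t)"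
        using K tK by (simp_all add: K.m_ac)
      then have "a \<otimes>\<^bsub>K\<^esub> b \<otimes>\<^bsub>K\<^esub> t \<in> carrier D" using at a b by (metis m_closed)
      then show ?thesis using c t unfolding contracted_def by blast
    qed
    then show "contracted V a \<and> contracted V b"
      using nz a b by (simp add: contracted_def)
  }
  assume c: "contracted V a \<and> contracted V b"
  have "t \<in> carrier D" if t: "t \<in> V" and abt: "a \<otimes>\<^bsub>K\<^esub> b \<otimes>\<^bsub>K\<^esub> t \<in> carrier D" for t
  proof -
    have "b \<otimes>\<^bsub>K\<^esub> t \<in> V"
      using subringE(6)[OF valuation_overring_subring(1)[OF V]] t b DV by blast
    moreover have "a \<otimes>\<^bsub>K\<^esub> (b \<otimes>\<^bsub>K\<^esub> t) \<in> carrier D" using abt K t VK by (simp add: K.m_assoc subset_iff)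
    ultimately have "b \<otimes>\<^bsub>K\<^esub> t \<in> carrier D" using c unfolding contracted_def by blast
    then show ?thesis using c t unfolding contracted_def by blast
  qed
  moreover have "a \<otimes>\<^bsub>K\<^esub> b \<noteq> \<zero>\<^bsub>K\<^esub>" using c K by (simp add: contracted_def K.integral_iff)
  ultimately show "contracted V (a \<otimes>\<^bsub>K\<^esub> b)"
    using a b by (simp add: contracted_def m_closed)
qed

lemma contracted_nat_pow:
  assumes V: "valuation_overring V" and a: "contracted V a"
  shows "contracted V (a [^]\<^bsub>K\<^esub> (m::nat))"
proof (induction m)
  case 0
  have "V \<subseteq> carrier K" using valuation_overring_subring[OF V] subringE(1) by blast
  then show ?case using D.one_closed unfolding contracted_def by auto
next
  case (Suc m)
  have "a \<in> carrier D" using a unfolding contracted_def by blast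
  then show ?case
    using Suc.IH a contracted_mult_iff[OF V nat_pow_closed[of a m], of a] by simp
qed

lemma comparable_in_valuation_overring:
  assumes V: "valuation_overring V" and x: "x \<in> carrier D" and y: "y \<in> carrier D"
  shows "\<exists>t\<in>V. x = y \<otimes>\<^bsub>K\<^esub> t \<or> y = x \<otimes>\<^bsub>K\<^esub> t"
proof (cases "x = \<zero>\<^bsub>K\<^esub> \<or> y = \<zero>\<^bsub>K\<^esub>")
  case True
  have "\<zero>\<^bsub>K\<^esub> \<in> V" using valuation_overring_subring(1)[OF V] subringE(2) by blast
  moreover have "x = y \<otimes>\<^bsub>K\<^esub> \<zero>\<^bsub>K\<^esub> \<or> y = x \<otimes>\<^bsub>K\<^esub> \<zero>\<^bsub>K\<^esub>"
    using True K.r_null[OF carrier_subset[OF x]] K.r_null[OF carrier_subset[OF y]] by auto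
  ultimately show ?thesis by blast
next
  case False
  have K: "x \<in> Units K" "y \<in> Units K" "x \<in> carrier K" "y \<in> carrier K"
    using x y False carrier_subset K.field_Units by auto
  let ?t = "inv\<^bsub>K\<^esub> y \<otimes>\<^bsub>K\<^esub> x"
  have tU: "?t \<in> Units K" using K by blast
  then have t: "?t \<in> carrier K - {\<zero>\<^bsub>K\<^esub>}" using K.field_Units by auto
  have xt: "x = y \<otimes>\<^bsub>K\<^esub> ?t" using K by (simp add: K.m_assoc[symmetric])
  have "y = (y \<otimes>\<^bsub>K\<^esub> ?t) \<otimes>\<^bsub>K\<^esub> inv\<^bsub>K\<^esub> ?t"
    using K(4) tU by (simp add: K.m_assoc K.Units_closed del: K.Units_m_closed)
  then have "y = x \<otimes>\<^bsub>K\<^esub> inv\<^bsub>K\<^esub> ?t" using xt by simp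
  moreover have "?t \<in> V \<or> inv\<^bsub>K\<^esub> ?t \<in> V"
    using V t unfolding valuation_overring_def valuation_domain_def by auto
  ultimately show ?thesis using xt by blast
qed

text \<open>
  Elements of \<open>D\<close> are comparable in \<open>V\<close>; the quotient that lies in \<open>V\<close> multiplies a contracted
  element into \<open>D\<close>, so it lies in \<open>D\<close>.
\<close>

lemma contracted_comparable:
  assumes V: "valuation_overring V" and a: "contracted V a" and b: "contracted V b"
  shows "PIdl\<^bsub>D\<^esub> a \<subseteq> PIdl\<^bsub>D\<^esub> b \<or> PIdl\<^bsub>D\<^esub> b \<subseteq> PIdl\<^bsub>D\<^esub> a"
proof -
  have D: "a \<in> carrier D" "b \<in> carrier D" using a b unfolding contracted_def by auto
  obtain t where t: "t \<in> V" "a = b \<otimes>\<^bsub>K\<^esub> t \<or> b = a \<otimes>\<^bsub>K\<^esub> t"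
    using comparable_in_valuation_overring[OF V D] by blast
  then have "t \<in> carrier D" using a b D unfolding contracted_def by metis
  then have "b divides\<^bsub>D\<^esub> a \<or> a divides\<^bsub>D\<^esub> b" using t(2) unfolding factor_def by auto
  then show ?thesis using D.to_contain_is_to_divide D by blast
qed

section \<open>The radical of a valuation element\<close>

lemma valuation_element_closed: "valuation_element D K a \<Longrightarrow> a \<in> carrier D"
  unfolding valuation_element_def nonzero_nonunits_def by blast

lemma mem_radical_iff:
  assumes "a \<in> carrier D"
  shows "x \<in> ideal_radical D (PIdl\<^bsub>D\<^esub> a) \<longleftrightarrow>
    x \<in> carrier D \<and> (\<exists>m\<ge>1. \<exists>d\<in>carrier D. x [^]\<^bsub>K\<^esub> (m::nat) = a \<otimes>\<^bsub>K\<^esub> d)"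
  unfolding ideal_radical_def PIdl_eq[OF assms] by auto

text \<open>
  Since \<open>a\<close> is contracted, the quotient \<open>t\<close> is already in \<open>D\<close>. Membership in the radical can thus be
  decided by divisibility in \<open>V\<close>, where any two elements are comparable.
\<close>

lemma mem_radical_overring:
  assumes V: "valuation_overring V" and a: "contracted V a" and x: "x \<in> carrier D"
    and m: "m \<ge> (1::nat)" and t: "t \<in> V" "x [^]\<^bsub>K\<^esub> m = a \<otimes>\<^bsub>K\<^esub> t"
  shows "x \<in> ideal_radical D (PIdl\<^bsub>D\<^esub> a)"
proof -
  have aD: "a \<in> carrier D" using a unfolding contracted_def by blast
  have "a \<otimes>\<^bsub>K\<^esub> t \<in> carrier D" using nat_pow_closed[OF x, of m] t(2) by simp
  then have "t \<in> carrier D" using a t(1) unfolding contracted_def by blast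
  then show ?thesis using mem_radical_iff[OF aD] x m t(2) by blast
qed

text \<open>
  Of two elements \<open>x, y\<close> of \<open>D\<close>, one divides the other in \<open>V\<close>, say \<open>x = yt\<close>. Then \<open>x + y\<close> is the
  \<open>V\<close>-multiple \<open>y(1 + t)\<close> of \<open>y\<close>, and \<open>x\<^sup>2\<close> is the \<open>V\<close>-multiple \<open>xyt\<close> of \<open>xy\<close>. Since the radical absorbs
  \<open>V\<close>-multiples that lie in \<open>D\<close>, the first equation gives closure under addition. The second
  puts \<open>x\<^sup>2\<close>, and with it \<open>x\<close>, into the radical when \<open>xy\<close> is there, which is primality.
\<close>

lemma radical_primeideal:
  assumes "valuation_element D K a"
  shows "primeideal (ideal_radical D (PIdl\<^bsub>D\<^esub> a)) D"
proof -
  obtain V where V: "valuation_overring V" and c: "contracted V a" and a: "a \<in> nonzero_nonunits D"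
    using assms valuation_element_iff_contracted by blast
  let ?P = "ideal_radical D (PIdl\<^bsub>D\<^esub> a)"
  have aD: "a \<in> carrier D" and aK: "a \<in> carrier K"
    using a carrier_subset unfolding nonzero_nonunits_def by auto
  note mem = mem_radical_iff[OF aD]
  note sub = valuation_overring_subring(1)[OF V]
  have VK: "V \<subseteq> carrier K" and DV: "carrier D \<subseteq> V"
    using valuation_overring_subring[OF V] subringE(1) by blast+
  have Vpow: "t [^]\<^bsub>K\<^esub> (m::nat) \<in> V" if "t \<in> V" for t m
    using that subringE(3,6)[OF sub] by (induction m) auto
  \<comment> \<open>The radical absorbs \<open>V\<close>-multiples that lie in \<open>D\<close>.\<close>
  have mult: "y \<in> ?P"
    if x: "x \<in> ?P" and y: "y \<in> carrier D" and t: "t \<in> V" and eq: "y = x \<otimes>\<^bsub>K\<^esub> t" for x y t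
  proof -
    obtain m d where m: "m \<ge> (1::nat)" and d: "d \<in> carrier D" "x [^]\<^bsub>K\<^esub> m = a \<otimes>\<^bsub>K\<^esub> d" and xD: "x \<in> carrier D"
      using x mem by blast
    have "y [^]\<^bsub>K\<^esub> m = a \<otimes>\<^bsub>K\<^esub> (d \<otimes>\<^bsub>K\<^esub> t [^]\<^bsub>K\<^esub> m)"
      using eq d t VK xD aK carrier_subset by (simp add: K.nat_pow_distrib K.m_assoc subset_iff)
    moreover have "d \<otimes>\<^bsub>K\<^esub> t [^]\<^bsub>K\<^esub> m \<in> V" using subringE(6)[OF sub] d DV Vpow t by blast
    ultimately show ?thesis using mem_radical_overring[OF V c y m] by blast
  qed
  have sq: "x \<in> ?P" if xD: "x \<in> carrier D" and x: "x \<otimes>\<^bsub>K\<^esub> x \<in> ?P" for x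
  proof -
    obtain m d where m: "m \<ge> (1::nat)" and d: "d \<in> carrier D" "(x \<otimes>\<^bsub>K\<^esub> x) [^]\<^bsub>K\<^esub> m = a \<otimes>\<^bsub>K\<^esub> d"
      using x mem by blast
    have "x [^]\<^bsub>K\<^esub> (m + m) = a \<otimes>\<^bsub>K\<^esub> d"
      using d xD carrier_subset by (simp add: K.nat_pow_distrib K.nat_pow_mult)
    then show ?thesis using mem xD d m by (meson le_add1 order_trans)
  qed
  have add: "x \<oplus>\<^bsub>K\<^esub> y \<in> ?P" if x: "x \<in> ?P" and y: "y \<in> ?P" for x y
  proof -
    have xy: "x \<in> carrier D" "y \<in> carrier D" using x y mem by auto
    then have xyK: "x \<in> carrier K" "y \<in> carrier K" using carrier_subset by auto
    have s: "x \<oplus>\<^bsub>K\<^esub> y \<in> carrier D" using D.a_closed xy by simp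
    obtain t where t: "t \<in> V" "x = y \<otimes>\<^bsub>K\<^esub> t \<or> y = x \<otimes>\<^bsub>K\<^esub> t"
      using comparable_in_valuation_overring[OF V xy] by blast
    have t1: "\<one>\<^bsub>K\<^esub> \<oplus>\<^bsub>K\<^esub> t \<in> V" using subringE(3,7)[OF sub] t by blast
    have tK: "t \<in> carrier K" using t VK by blast
    have "x \<oplus>\<^bsub>K\<^esub> y = y \<otimes>\<^bsub>K\<^esub> (\<one>\<^bsub>K\<^esub> \<oplus>\<^bsub>K\<^esub> t) \<or> x \<oplus>\<^bsub>K\<^esub> y = x \<otimes>\<^bsub>K\<^esub> (\<one>\<^bsub>K\<^esub> \<oplus>\<^bsub>K\<^esub> t)"
      using t(2) xyK tK by (metis K.r_distr K.r_one K.one_closed K.a_comm)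
    then show ?thesis using mult[OF x s t1] mult[OF y s t1] by blast
  qed
  have zero: "\<zero>\<^bsub>K\<^esub> \<in> ?P"
    unfolding mem using D.zero_closed aK by (auto intro!: exI[of _ 1] bexI[of _ "\<zero>\<^bsub>K\<^esub>"])
  have smult: "x \<otimes>\<^bsub>K\<^esub> r \<in> ?P" "r \<otimes>\<^bsub>K\<^esub> x \<in> ?P" if x: "x \<in> ?P" and r: "r \<in> carrier D" for x r
  proof -
    have xD: "x \<in> carrier D" using x mem by blast
    show "x \<otimes>\<^bsub>K\<^esub> r \<in> ?P" using mult[OF x m_closed[OF xD r] _ refl] r DV by blast
    then show "r \<otimes>\<^bsub>K\<^esub> x \<in> ?P" using K.m_comm xD r carrier_subset by simp
  qed
  have ideal: "ideal ?P D"
  proof (rule idealI[OF D.ring_axioms])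
    have "\<ominus>\<^bsub>D\<^esub> x \<in> ?P" if x: "x \<in> ?P" for x
    proof -
      have xD: "x \<in> carrier D" using x mem by blast
      have "\<ominus>\<^bsub>D\<^esub> x = (\<ominus>\<^bsub>D\<^esub> \<one>\<^bsub>D\<^esub>) \<otimes>\<^bsub>D\<^esub> x" using xD D.l_minus D.l_one D.one_closed by metis
      then show ?thesis using smult(2)[OF x] D.a_inv_closed[OF D.one_closed] by simp
    qed
    then show "subgroup ?P (add_monoid D)"
      using mem zero add by (intro D.add.subgroupI) (auto simp: a_inv_def)
  qed (use smult in auto)
  show ?thesis
  proof (rule primeidealI[OF ideal D.cring_axioms])
    have "\<one>\<^bsub>K\<^esub> \<notin> ?P"
    proof
      assume "\<one>\<^bsub>K\<^esub> \<in> ?P"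
      then obtain d where d: "d \<in> carrier D" "a \<otimes>\<^bsub>D\<^esub> d = \<one>\<^bsub>D\<^esub>" using mem by auto
      moreover have "d \<otimes>\<^bsub>D\<^esub> a = \<one>\<^bsub>D\<^esub>" using d D.m_comm[OF aD d(1)] by (simp del: operations_agree)
      ultimately have "a \<in> Units D" using aD unfolding Units_def by blast
      then show False using a unfolding nonzero_nonunits_def by blast
    qed
    then show "carrier D \<noteq> ?P" using D.one_closed by auto
  next
    fix x y assume x: "x \<in> carrier D" and y: "y \<in> carrier D" and "x \<otimes>\<^bsub>D\<^esub> y \<in> ?P"
    then have xy: "x \<otimes>\<^bsub>K\<^esub> y \<in> ?P" by simp
    have K: "x \<in> carrier K" "y \<in> carrier K" using x y carrier_subset by auto
    obtain t where t: "t \<in> V" "x = y \<otimes>\<^bsub>K\<^esub> t \<or> y = x \<otimes>\<^bsub>K\<^esub> t"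
      using comparable_in_valuation_overring[OF V x y] by blast
    have tK: "t \<in> carrier K" using t VK by blast
    have "x \<otimes>\<^bsub>K\<^esub> x = x \<otimes>\<^bsub>K\<^esub> y \<otimes>\<^bsub>K\<^esub> t \<or> y \<otimes>\<^bsub>K\<^esub> y = x \<otimes>\<^bsub>K\<^esub> y \<otimes>\<^bsub>K\<^esub> t"
      using t(2) K tK by (metis K.m_assoc K.m_comm)
    then have "x \<otimes>\<^bsub>K\<^esub> x \<in> ?P \<or> y \<otimes>\<^bsub>K\<^esub> y \<in> ?P"
      using mult[OF xy _ t(1)] x y by (metis m_closed)
    then show "x \<in> ?P \<or> y \<in> ?P" using sq x y by blast
  qed
qed

lemma self_mem_radical: "a \<in> carrier D \<Longrightarrow> a \<in> ideal_radical D (PIdl\<^bsub>D\<^esub> a)"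
  using mem_radical_iff[of a a] D.one_closed carrier_subset
  by (auto intro!: exI[of _ 1] bexI[of _ "\<one>\<^bsub>K\<^esub>"])

lemma radical_subset_primeideal:
  assumes "primeideal P D" and "a \<in> P"
  shows "ideal_radical D (PIdl\<^bsub>D\<^esub> a) \<subseteq> P"
proof
  interpret P: primeideal P D by fact
  fix x assume "x \<in> ideal_radical D (PIdl\<^bsub>D\<^esub> a)"
  then obtain m :: nat where "x \<in> carrier D" "x [^]\<^bsub>D\<^esub> m \<in> PIdl\<^bsub>D\<^esub> a"
    unfolding ideal_radical_def by blast
  then show "x \<in> P" using P.nat_pow_mem_imp_mem D.cgenideal_minimal[OF P.ideal_axioms assms(2)] by blast
qed

text \<open>
  An element of \<open>\<surd>(yD)\<close> has a power divisible by \<open>y\<close>. Powers and divisors of contracted elements are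
  contracted, so \<open>y\<close> is contracted from the overring that belongs to \<open>x\<close>, where the two can be
  compared.
\<close>

lemma incomparable_iff_radicals_incomparable:
  assumes a: "valuation_element D K a" and b: "valuation_element D K b"
  shows "incomparable D a b \<longleftrightarrow>
    incomparable_ideals (ideal_radical D (PIdl\<^bsub>D\<^esub> a)) (ideal_radical D (PIdl\<^bsub>D\<^esub> b))"
proof -
  have radical_mono: "ideal_radical D I \<subseteq> ideal_radical D J" if "I \<subseteq> J" for I J
    using that unfolding ideal_radical_def by blast
  have *: "PIdl\<^bsub>D\<^esub> x \<subseteq> PIdl\<^bsub>D\<^esub> y \<or> PIdl\<^bsub>D\<^esub> y \<subseteq> PIdl\<^bsub>D\<^esub> x"
    if x: "valuation_element D K x" and y: "valuation_element D K y"
      and sub: "ideal_radical D (PIdl\<^bsub>D\<^esub> x) \<subseteq> ideal_radical D (PIdl\<^bsub>D\<^esub> y)" for x y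
  proof -
    have D: "x \<in> carrier D" "y \<in> carrier D" using x y valuation_element_closed by auto
    obtain V where V: "valuation_overring V" and c: "contracted V x"
      using x valuation_element_iff_contracted by blast
    have "x \<in> ideal_radical D (PIdl\<^bsub>D\<^esub> y)" using sub self_mem_radical D by blast
    then obtain m d where d: "d \<in> carrier D" "x [^]\<^bsub>K\<^esub> (m::nat) = y \<otimes>\<^bsub>K\<^esub> d"
      using mem_radical_iff D by blast
    then have "contracted V y"
      using contracted_nat_pow[OF V c, of m] contracted_mult_iff[OF V D(2) d(1)] by simp
    then show ?thesis using contracted_comparable[OF V c] by blast
  qed
  show ?thesis
    unfolding incomparable_def incomparable_ideals_def using *[OF a b] *[OF b a] radical_mono by blast
qed

text \<open>
  If \<open>b\<close> is contracted from \<open>V\<close>, then so is its divisor \<open>a\<close>, and therefore the product.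
\<close>

lemma valuation_element_mult:
  assumes a: "valuation_element D K a" and b: "valuation_element D K b"
    and sub: "PIdl\<^bsub>D\<^esub> b \<subseteq> PIdl\<^bsub>D\<^esub> a"
  shows "valuation_element D K (a \<otimes>\<^bsub>K\<^esub> b)"
proof -
  have D: "a \<in> carrier D" "b \<in> carrier D" using a b valuation_element_closed by auto
  obtain V where V: "valuation_overring V" and c: "contracted V b"
    using b valuation_element_iff_contracted by blast
  obtain d where d: "d \<in> carrier D" "b = a \<otimes>\<^bsub>K\<^esub> d"
    using sub D.cgenideal_self[OF D(2)] PIdl_eq[OF D(1)] by blast
  have "contracted V a" using c contracted_mult_iff[OF V D(1) d(1)] d(2) by simp
  then have cab: "contracted V (a \<otimes>\<^bsub>K\<^esub> b)" using c contracted_mult_iff[OF V D] by simp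
  have "a \<otimes>\<^bsub>K\<^esub> b \<notin> Units D"
    using D.unit_factor[of a b] D a unfolding valuation_element_def nonzero_nonunits_def by auto
  then have "a \<otimes>\<^bsub>K\<^esub> b \<in> nonzero_nonunits D"
    using cab unfolding contracted_def nonzero_nonunits_def by auto
  then show ?thesis using V cab valuation_element_iff_contracted by blast
qed

lemma minimal_primes_of_product:
  assumes fin: "finite I" and val: "\<And>i. i \<in> I \<Longrightarrow> valuation_element D K (a i)"
  defines "S \<equiv> (\<lambda>i. ideal_radical D (PIdl\<^bsub>D\<^esub> (a i))) ` I"
  shows "minimal_primes D (PIdl\<^bsub>D\<^esub> (finprod D a I)) = {P \<in> S. \<forall>Q\<in>S. Q \<subseteq> P \<longrightarrow> Q = P}"
proof (rule D.minimal_primes_eq_minimal_elements)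
  have aD: "a \<in> I \<rightarrow> carrier D" using val valuation_element_closed by blast
  {
    fix P assume "P \<in> S"
    then obtain i where i: "i \<in> I" "P = ideal_radical D (PIdl\<^bsub>D\<^esub> (a i))"
      unfolding S_def by blast
    then have P: "primeideal P D" using radical_primeideal val by blast
    then interpret P: primeideal P D .
    have "a i \<in> P" using i self_mem_radical aD by blast
    then have "finprod D a I \<in> P" using P.finprod_mem_iff[OF fin aD] i by blast
    then show "primeideal P D \<and> PIdl\<^bsub>D\<^esub> (finprod D a I) \<subseteq> P"
      using P D.cgenideal_minimal[OF P.ideal_axioms] by blast
  next
    fix P assume P: "primeideal P D" and sub: "PIdl\<^bsub>D\<^esub> (finprod D a I) \<subseteq> P"
    interpret P: primeideal P D by fact
    have "finprod D a I \<in> P" using sub D.cgenideal_self[OF D.finprod_closed[OF aD]] by blast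
    then obtain i where "i \<in> I" "a i \<in> P" using P.finprod_mem_iff[OF fin aD] by blast
    then show "\<exists>Q\<in>S. Q \<subseteq> P" using radical_subset_primeideal[OF P] unfolding S_def by blast
  }
qed

section \<open>The equivalences and the merging of factors\<close>

lemma incomparable_factors_tfae:
  assumes fin: "finite I" and val: "\<And>i. i \<in> I \<Longrightarrow> valuation_element D K (a i)"
  defines "f \<equiv> \<lambda>i. ideal_radical D (PIdl\<^bsub>D\<^esub> (a i))"
    and "M \<equiv> minimal_primes D (PIdl\<^bsub>D\<^esub> (finprod D a I))"
  shows "(\<forall>i\<in>I. \<forall>j\<in>I. i \<noteq> j \<longrightarrow> incomparable D (a i) (a j)) \<longleftrightarrow>
      (\<forall>i\<in>I. \<forall>j\<in>I. i \<noteq> j \<longrightarrow> incomparable_ideals (f i) (f j))"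
    and "(\<forall>i\<in>I. \<forall>j\<in>I. i \<noteq> j \<longrightarrow> incomparable_ideals (f i) (f j)) \<longleftrightarrow> bij_betw f I M"
    and "bij_betw f I M \<longleftrightarrow> finite M \<and> card I = card M"
proof -
  have "incomparable D (a i) (a j) \<longleftrightarrow> incomparable_ideals (f i) (f j)" if "i \<in> I" "j \<in> I" for i j
    unfolding f_def using that val by (intro incomparable_iff_radicals_incomparable)
  then show "(\<forall>i\<in>I. \<forall>j\<in>I. i \<noteq> j \<longrightarrow> incomparable D (a i) (a j)) \<longleftrightarrow>
      (\<forall>i\<in>I. \<forall>j\<in>I. i \<noteq> j \<longrightarrow> incomparable_ideals (f i) (f j))" by simp
  have M: "M = {P \<in> f ` I. \<forall>Q \<in> f ` I. Q \<subseteq> P \<longrightarrow> Q = P}"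
    unfolding M_def f_def by (rule minimal_primes_of_product[OF fin val])
  show "(\<forall>i\<in>I. \<forall>j\<in>I. i \<noteq> j \<longrightarrow> incomparable_ideals (f i) (f j)) \<longleftrightarrow> bij_betw f I M"
    and "bij_betw f I M \<longleftrightarrow> finite M \<and> card I = card M"
    using minimal_elements_of_finite_family[OF fin M] by blast+
qed

lemma merge_comparable_factors:
  assumes fin: "finite I" and val: "\<And>i. i \<in> I \<Longrightarrow> valuation_element D K (a i)"
    and ij: "i \<in> I" "j \<in> I" "i \<noteq> j" and sub: "PIdl\<^bsub>D\<^esub> (a j) \<subseteq> PIdl\<^bsub>D\<^esub> (a i)"
  defines "b \<equiv> a(i := a i \<otimes>\<^bsub>K\<^esub> a j)"
  shows "\<forall>k\<in>I - {j}. valuation_element D K (b k)" and "finprod D b (I - {j}) = finprod D a I"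
proof -
  show bval: "\<forall>k\<in>I - {j}. valuation_element D K (b k)"
    unfolding b_def using valuation_element_mult[OF val[OF ij(1)] val[OF ij(2)] sub] val by auto
  let ?J = "I - {i, j}"
  have I: "I = insert j (insert i ?J)" "I - {j} = insert i ?J" using ij by auto
  have aD: "\<And>k. k \<in> I \<Longrightarrow> a k \<in> carrier D" using val valuation_element_closed by blast
  have bD: "\<And>k. k \<in> I - {j} \<Longrightarrow> b k \<in> carrier D" using bval valuation_element_closed by blast
  have J: "finprod D b ?J = finprod D a ?J"
    by (rule D.finprod_cong') (auto simp: b_def aD)
  have pJ: "finprod D a ?J \<in> carrier D" using aD by (intro D.finprod_closed) auto
  have "finprod D b (insert i ?J) = b i \<otimes>\<^bsub>D\<^esub> finprod D b ?J"
    using fin bD ij by (intro D.finprod_insert) auto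
  also have "\<dots> = a j \<otimes>\<^bsub>D\<^esub> (a i \<otimes>\<^bsub>D\<^esub> finprod D a ?J)"
    using J pJ aD[OF ij(1)] aD[OF ij(2)] carrier_subset by (simp add: b_def K.m_ac)
  also have "a i \<otimes>\<^bsub>D\<^esub> finprod D a ?J = finprod D a (insert i ?J)"
    using fin aD ij by (intro D.finprod_insert[symmetric]) auto
  also have "a j \<otimes>\<^bsub>D\<^esub> finprod D a (insert i ?J) = finprod D a (insert j (insert i ?J))"
    using fin aD ij by (intro D.finprod_insert[symmetric]) auto
  finally show "finprod D b (I - {j}) = finprod D a I" by (simp only: I(2) I(1)[symmetric])
qed

text \<open>
  Merging two comparable factors shortens the product, so the process ends. Indexing by finite sets
  allows the merged index to be dropped without renumbering the others.
\<close>

lemma incomparable_factorization: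
  fixes I :: "'i set"
  assumes "finite I" and "I \<noteq> {}" and "\<And>i. i \<in> I \<Longrightarrow> valuation_element D K (a i)"
  shows "\<exists>J b. J \<subseteq> I \<and> J \<noteq> {} \<and> (\<forall>i\<in>J. valuation_element D K (b i)) \<and>
    (\<forall>i\<in>J. \<forall>j\<in>J. i \<noteq> j \<longrightarrow> incomparable D (b i) (b j)) \<and> finprod D b J = finprod D a I"
  using assms
proof (induction "card I" arbitrary: I a rule: less_induct)
  case less
  show ?case
  proof (cases "\<forall>i\<in>I. \<forall>j\<in>I. i \<noteq> j \<longrightarrow> incomparable D (a i) (a j)")
    case True
    then show ?thesis using less.prems by blast
  next
    case False
    then obtain i j where ij: "i \<in> I" "j \<in> I" "i \<noteq> j" "PIdl\<^bsub>D\<^esub> (a j) \<subseteq> PIdl\<^bsub>D\<^esub> (a i)"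
      unfolding incomparable_def incomparable_ideals_def by metis
    note merge = merge_comparable_factors[OF less.prems(1,3) ij]
    let ?b = "a(i := a i \<otimes>\<^bsub>K\<^esub> a j)"
    have "card (I - {j}) < card I" using less.prems(1) ij(2) by (rule card_Diff1_less)
    moreover have "finite (I - {j})" "I - {j} \<noteq> {}" using less.prems(1) ij by auto
    ultimately obtain J b where "J \<subseteq> I - {j}" "J \<noteq> {}" "\<forall>i\<in>J. valuation_element D K (b i)"
        "\<forall>i\<in>J. \<forall>j\<in>J. i \<noteq> j \<longrightarrow> incomparable D (b i) (b j)" "finprod D b J = finprod D ?b (I - {j})"
      using less.hyps[of "I - {j}" ?b, OF _ _ _ bspec[OF merge(1)]] by blast
    moreover from this have "J \<subseteq> I" by blast
    ultimately show ?thesis using merge(2) by (intro exI[of _ J] exI[of _ b] conjI) simp_all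
  qed
qed

end

theorem proposition1p13:
  fixes D K :: "('a, 'm) ring_scheme"
  assumes "domain D" and "quotient_field D K" and "VFD D K"
  shows
    "(\<forall>(n::nat) (a :: nat \<Rightarrow> 'a).
        n \<ge> 1 \<and> (\<forall>i\<in>{1..n}. valuation_element D K (a i)) \<longrightarrow>
        (let x = (\<Otimes>\<^bsub>D\<^esub>i\<in>{1..n}. a i);
             S1 = (\<forall>i\<in>{1..n}. \<forall>j\<in>{1..n}. i \<noteq> j \<longrightarrow> incomparable D (a i) (a j));
             S2 = (\<forall>i\<in>{1..n}. \<forall>j\<in>{1..n}. i \<noteq> j \<longrightarrow>
                     incomparable_ideals (ideal_radical D (PIdl\<^bsub>D\<^esub> (a i)))
                                         (ideal_radical D (PIdl\<^bsub>D\<^esub> (a j))));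
             S3 = bij_betw (\<lambda>i. ideal_radical D (PIdl\<^bsub>D\<^esub> (a i))) {1..n}
                           (minimal_primes D (PIdl\<^bsub>D\<^esub> x));
             S4 = (finite (minimal_primes D (PIdl\<^bsub>D\<^esub> x)) \<and>
                   n = card (minimal_primes D (PIdl\<^bsub>D\<^esub> x)))
         in (S1 \<longleftrightarrow> S2) \<and> (S2 \<longleftrightarrow> S3) \<and> (S3 \<longleftrightarrow> S4)))
     \<and>
     (\<forall>x\<in>nonzero_nonunits D.
        \<exists>(n::nat) (b :: nat \<Rightarrow> 'a).
          n \<ge> 1 \<and> (\<forall>i\<in>{1..n}. valuation_element D K (b i)) \<and>
          (\<forall>i\<in>{1..n}. \<forall>j\<in>{1..n}. i \<noteq> j \<longrightarrow> incomparable D (b i) (b j)) \<and>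
          x = (\<Otimes>\<^bsub>D\<^esub>i\<in>{1..n}. b i))"
proof -
  interpret domain_in_quotient_field D K
    using assms(1,2)
    by (auto simp: domain_in_quotient_field_def domain_in_quotient_field_axioms_def quotient_field_def)
  have factorizations: "\<forall>x\<in>nonzero_nonunits D.
        \<exists>(n::nat) (b :: nat \<Rightarrow> 'a).
          n \<ge> 1 \<and> (\<forall>i\<in>{1..n}. valuation_element D K (b i)) \<and>
          (\<forall>i\<in>{1..n}. \<forall>j\<in>{1..n}. i \<noteq> j \<longrightarrow> incomparable D (b i) (b j)) \<and>
          x = (\<Otimes>\<^bsub>D\<^esub>i\<in>{1..n}. b i)"
  proof
    fix x assume "x \<in> nonzero_nonunits D"
    then obtain n :: nat and a where n: "n \<ge> 1" "\<forall>i\<in>{1..n}. valuation_element D K (a i)"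
      and x: "x = finprod D a {1..n}"
      using assms(3) unfolding VFD_def by blast
    obtain J b where J: "J \<subseteq> {1..n}" "J \<noteq> {}" and b: "\<forall>i\<in>J. valuation_element D K (b i)"
        "\<forall>i\<in>J. \<forall>j\<in>J. i \<noteq> j \<longrightarrow> incomparable D (b i) (b j)" and xb: "finprod D b J = x"
      using incomparable_factorization[of "{1..n}" a] n x by auto
    have finJ: "finite J" using J(1) finite_subset by blast
    obtain h where h: "bij_betw h {1..card J} J"
      using ex_bij_betw_nat_finite_1[OF finJ] by blast
    have "card J \<ge> 1" using J(2) finJ by (simp add: Suc_leI card_gt_0_iff)
    moreover have hJ: "h i \<in> J" if "i \<in> {1..card J}" for i using h that bij_betwE by blast
    moreover have "h i \<noteq> h j" if "i \<in> {1..card J}" "j \<in> {1..card J}" "i \<noteq> j" for i j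
      using inj_onD[OF bij_betw_imp_inj_on[OF h]] that by blast
    moreover have "x = (\<Otimes>\<^bsub>D\<^esub>i\<in>{1..card J}. b (h i))"
    proof -
      have "b \<in> h ` {1..card J} \<rightarrow> carrier D"
        using h b(1) valuation_element_closed by (auto simp: bij_betw_def)
      then show ?thesis
        using h D.finprod_reindex[of b h "{1..card J}"] xb by (simp add: bij_betw_def)
    qed
    ultimately show "\<exists>(n::nat) (b :: nat \<Rightarrow> 'a).
          n \<ge> 1 \<and> (\<forall>i\<in>{1..n}. valuation_element D K (b i)) \<and>
          (\<forall>i\<in>{1..n}. \<forall>j\<in>{1..n}. i \<noteq> j \<longrightarrow> incomparable D (b i) (b j)) \<and>
          x = (\<Otimes>\<^bsub>D\<^esub>i\<in>{1..n}. b i)"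
      using b by (intro exI[of _ "card J"] exI[of _ "\<lambda>i. b (h i)"]) simp
  qed
  show ?thesis
  proof (intro conjI factorizations allI impI, elim conjE)
    fix n :: nat and a :: "nat \<Rightarrow> 'a"
    assume val: "\<forall>i\<in>{1..n}. valuation_element D K (a i)"
    note tfae = incomparable_factors_tfae[of "{1..n}" a, OF finite_atLeastAtMost bspec[OF val]]
    show "let x = (\<Otimes>\<^bsub>D\<^esub>i\<in>{1..n}. a i);
             S1 = (\<forall>i\<in>{1..n}. \<forall>j\<in>{1..n}. i \<noteq> j \<longrightarrow> incomparable D (a i) (a j));
             S2 = (\<forall>i\<in>{1..n}. \<forall>j\<in>{1..n}. i \<noteq> j \<longrightarrow>
                     incomparable_ideals (ideal_radical D (PIdl\<^bsub>D\<^esub> (a i)))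
                                         (ideal_radical D (PIdl\<^bsub>D\<^esub> (a j))));
             S3 = bij_betw (\<lambda>i. ideal_radical D (PIdl\<^bsub>D\<^esub> (a i))) {1..n}
                           (minimal_primes D (PIdl\<^bsub>D\<^esub> x));
             S4 = (finite (minimal_primes D (PIdl\<^bsub>D\<^esub> x)) \<and>
                   n = card (minimal_primes D (PIdl\<^bsub>D\<^esub> x)))
         in (S1 \<longleftrightarrow> S2) \<and> (S2 \<longleftrightarrow> S3) \<and> (S3 \<longleftrightarrow> S4)"
      unfolding Let_def using tfae by simp
  qed
qed

end
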